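(* Suppose the system $x_{t+1}=f(x_t,u_t,w_t)$, $y_t=h(x_t,u_t,w_t)$ admits a quadratically bounded (exponential) $\delta$-IOSS Lyapunov function $W_\delta$ with constants $\eta\in[0,1)$, $P_1,P_2\succ0$, $Q,R\succeq0$ (as defined in the context), and let $\hat x_t$ be the state estimates generated by the MHE scheme with horizon $M\in\mathbb{I}_{\ge0}$ described in the context, using these $\eta,P_2,Q,R$ in its cost. Then, for all $t\in\mathbb{I}_{\ge 0}$, with $M_t=\min\{t,M\}$, $$W_\delta(\hat{x}_t,x_t)\leq 4\eta^{M_t}\lambda_{\max}(P_2,P_1)\, W_\delta(\hat{x}_{t-M_t},x_{t-M_t})+4\sum_{j=1}^{M_t}\eta^{j-1}\|w_{t-j}\|_Q^2 .$$
   Context: Notation: $\mathbb{I}_{\ge a}$ is the set of integers $\ge a$, $\mathbb{I}_{[a,b]}$ the integers in $[a,b]$. $\|x\|_Q^2=x^\top Qx$ for symmetric positive (semi)definite $Q$. For symmetric positive definite $A,B$, $\lambda_{\max}(A,B)$ is the maximum generalized eigenvalue, i.e. the largest $\lambda$ with $\det(A-\lambda B)=0$. Convention: $0^0=1$; empty sums are $0$. System: $x_{t+1}=f(x_t,u_t,w_t)$, $y_t=h(x_t,u_t,w_t)$, $t\in\mathbb{I}_{\ge0}$, with $f:\mathbb{R}^n\times\mathbb{R}^m\times\mathbb{R}^q\to\mathbb{R}^n$, $h:\mathbb{R}^n\times\mathbb{R}^m\times\mathbb{R}^q\to\mathbb{R}^p$ continuous. State $x_t$, known input $u_t$, unknown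 disturbance $w_t$, measured output $y_t$. The true trajectory satisfies $(x_t,u_t,w_t,y_t)\in\mathbb{Z}:=\mathbb{X}\times\mathbb{U}\times\mathbb{W}\times\mathbb{Y}$ for all $t\in\mathbb{I}_{\ge0}$, where $\mathbb{X}\subseteq\mathbb{R}^n$, $\mathbb{U}\subseteq\mathbb{R}^m$, $\mathbb{W}\subseteq\mathbb{R}^q$, $\mathbb{Y}\subseteq\mathbb{R}^p$. An initial guess $\hat x_0\in\mathbb{X}$ of $x_0$ is given. Quadratically bounded (exponential) $\delta$-IOSS Lyapunov function: a function $W_\delta:\mathbb{R}^n\times\mathbb{R}^n\to\mathbb{R}_{\ge0}$ for which there exist $\eta\in[0,1)$ and symmetric matrices $P_1,P_2\succ0$, $Q,R\succeq0$ such that both (a) $\|x-\tilde x\|_{P_1}^2\le W_\delta(x,\tilde x)\le\|x-\tilde x\|_{P_2}^2$ and (b) $W_\delta(f(x,u,w),f(\tilde x,u,\tilde w))\le\eta W_\delta(x,\tilde x)+\|w-\tilde w\|_Q^2+\|y-\tilde y\|_R^2$ hold for all $(x,u,w,y),(\tilde x,u,\tilde w,\tilde y)\in\mathbb{Z}$, where $y=h(x,u,w)$ and $\tilde y=h(\tilde x,u,\tilde w)$. MHE scheme: fix a horizon $M\in\mathbb{I}_{\ge0}$ and let $M_t=\min\{t,M\}$. At each time $t\in\mathbb{I}_{\ge0}$, given the past estimate $\hat x_{t-M_t}$ and data $u_j,y_j$, $j\in\mathbb{I}_{[t-M_t,t-1]}$, minimize over $\hat x_{t-M_t|t}$ and $\hat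 w_{\cdot|t}=\{\hat w_{j|t}\}_{j=t-M_t}^{t-1}$ the cost $$V_{\mathrm{MHE}}(\hat x_{t-M_t|t},\hat w_{\cdot|t},\hat y_{\cdot|t},t)=2\eta^{M_t}\|\hat x_{t-M_t|t}-\hat x_{t-M_t}\|_{P_2}^2+\sum_{j=1}^{M_t}\eta^{j-1}\left(2\|\hat w_{t-j|t}\|_Q^2+\|\hat y_{t-j|t}-y_{t-j}\|_R^2\right)$$ subject to $\hat x_{j+1|t}=f(\hat x_{j|t},u_j,\hat w_{j|t})$, $\hat y_{j|t}=h(\hat x_{j|t},u_j,\hat w_{j|t})$, $\hat w_{j|t}\in\mathbb{W}$, $\hat y_{j|t}\in\mathbb{Y}$ for $j\in\mathbb{I}_{[t-M_t,t-1]}$, and $\hat x_{j|t}\in\mathbb{X}$ for $j\in\mathbb{I}_{[t-M_t,t]}$. A minimizer is assumed to exist at each $t$; it and the corresponding trajectories are denoted by $\hat x^*_{\cdot|t},\hat w^*_{\cdot|t},\hat y^*_{\cdot|t}$. The estimate at time $t$ is $\hat x_t=\hat x^*_{t|t}$ (at $t=0$ this is the initial guess $\hat x_0$).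
   Formalization: The bounds (a) on W_δ are assumed for all x, x̃ in X, without the restriction y = h(x,u,w), ỹ = h(x̃,u,w̃) in Y, which is kept only for (b); with that restriction also on (a) the claim fails, as the initial guess need only lie in X. *)

theory Defs
  imports "HOL-Analysis.Analysis"
begin

definition sqnorm :: "real^'k^'k \<Rightarrow> real^'k \<Rightarrow> real" where
  "sqnorm Q x = x \<bullet> (Q *v x)"

definition pos_def :: "real^'k^'k \<Rightarrow> bool" where
  "pos_def A \<longleftrightarrow> transpose A = A \<and> (\<forall>x. x \<noteq> 0 \<longrightarrow> 0 < x \<bullet> (A *v x))"

definition pos_semidef :: "real^'k^'k \<Rightarrow> bool" where
  "pos_semidef A \<longleftrightarrow> transpose A = A \<and> (\<forall>x. 0 \<le> x \<bullet> (A *v x))"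

definition lambda_max :: "real^'k^'k \<Rightarrow> real^'k^'k \<Rightarrow> real" where
  "lambda_max A B = (GREATEST l. det (A - l *\<^sub>R B) = 0)"

(* The output relation y = h x u w is only imposed in the dissipation inequality, the only place
   where outputs occur.  The quadratic bounds range over all pairs of tuples in Z with a common
   input; if Z = X \<times> U \<times> W \<times> Y is nonempty, they hold for all states in X, including an
   initial guess in X for which no disturbance yields an output in Y. *)
definition delta_IOSS_lyapunov ::
  "(real^'n \<Rightarrow> real^'m \<Rightarrow> real^'q \<Rightarrow> real^'n) \<Rightarrow> (real^'n \<Rightarrow> real^'m \<Rightarrow> real^'q \<Rightarrow> real^'p) \<Rightarrow>
   ((real^'n) \<times> (real^'m) \<times> (real^'q) \<times> (real^'p)) set \<Rightarrow> real \<Rightarrow> real^'n^'n \<Rightarrow> real^'n^'n \<Rightarrow>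
   real^'q^'q \<Rightarrow> real^'p^'p \<Rightarrow> (real^'n \<Rightarrow> real^'n \<Rightarrow> real) \<Rightarrow> bool" where
  "delta_IOSS_lyapunov f h Z \<eta> P1 P2 Q R V \<longleftrightarrow>
     0 \<le> \<eta> \<and> \<eta> < 1 \<and> pos_def P1 \<and> pos_def P2 \<and> pos_semidef Q \<and> pos_semidef R \<and>
     (\<forall>x x'. 0 \<le> V x x') \<and>
     (\<forall>x u w y x' w' y'. (x, u, w, y) \<in> Z \<and> (x', u, w', y') \<in> Z \<longrightarrow>
        sqnorm P1 (x - x') \<le> V x x' \<and> V x x' \<le> sqnorm P2 (x - x')) \<and>
     (\<forall>x u w y x' w' y'. (x, u, w, y) \<in> Z \<and> (x', u, w', y') \<in> Z \<and>
          y = h x u w \<and> y' = h x' u w' \<longrightarrow>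
        V (f x u w) (f x' u w') \<le> \<eta> * V x x' + sqnorm Q (w - w') + sqnorm R (y - y'))"

definition system_trajectory ::
  "(real^'n \<Rightarrow> real^'m \<Rightarrow> real^'q \<Rightarrow> real^'n) \<Rightarrow> (real^'n \<Rightarrow> real^'m \<Rightarrow> real^'q \<Rightarrow> real^'p) \<Rightarrow>
   ((real^'n) \<times> (real^'m) \<times> (real^'q) \<times> (real^'p)) set \<Rightarrow>
   (nat \<Rightarrow> real^'n) \<Rightarrow> (nat \<Rightarrow> real^'m) \<Rightarrow> (nat \<Rightarrow> real^'q) \<Rightarrow> (nat \<Rightarrow> real^'p) \<Rightarrow> bool" where
  "system_trajectory f h Z x u w y \<longleftrightarrow>
     (\<forall>t. x (t + 1) = f (x t) (u t) (w t) \<and> y t = h (x t) (u t) (w t) \<and>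
          (x t, u t, w t, y t) \<in> Z)"

(* Candidate sequences are total functions of absolute time j; xh j stands for the state at time j
   as estimated at time t.  Only the values of xh on [t - min t M, t] and of wh, yh on
   [t - min t M, t - 1] matter. *)
definition mhe_feasible ::
  "(real^'n \<Rightarrow> real^'m \<Rightarrow> real^'q \<Rightarrow> real^'n) \<Rightarrow> (real^'n \<Rightarrow> real^'m \<Rightarrow> real^'q \<Rightarrow> real^'p) \<Rightarrow>
   (real^'n) set \<Rightarrow> (real^'q) set \<Rightarrow> (real^'p) set \<Rightarrow> nat \<Rightarrow> (nat \<Rightarrow> real^'m) \<Rightarrow> nat \<Rightarrow>
   (nat \<Rightarrow> real^'n) \<Rightarrow> (nat \<Rightarrow> real^'q) \<Rightarrow> (nat \<Rightarrow> real^'p) \<Rightarrow> bool" where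
  "mhe_feasible f h X W Y M u t xh wh yh \<longleftrightarrow>
     (\<forall>j\<in>{t - min t M..<t}.
        xh (j + 1) = f (xh j) (u j) (wh j) \<and> yh j = h (xh j) (u j) (wh j) \<and>
        wh j \<in> W \<and> yh j \<in> Y) \<and>
     (\<forall>j\<in>{t - min t M..t}. xh j \<in> X)"

definition mhe_cost ::
  "real \<Rightarrow> real^'n^'n \<Rightarrow> real^'q^'q \<Rightarrow> real^'p^'p \<Rightarrow> nat \<Rightarrow> (nat \<Rightarrow> real^'p) \<Rightarrow> (nat \<Rightarrow> real^'n) \<Rightarrow>
   nat \<Rightarrow> (nat \<Rightarrow> real^'n) \<Rightarrow> (nat \<Rightarrow> real^'q) \<Rightarrow> (nat \<Rightarrow> real^'p) \<Rightarrow> real" where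
  "mhe_cost \<eta> P2 Q R M y xhat t xh wh yh =
     2 * \<eta> ^ min t M * sqnorm P2 (xh (t - min t M) - xhat (t - min t M)) +
     (\<Sum>j=1..min t M. \<eta> ^ (j - 1) *
        (2 * sqnorm Q (wh (t - j)) + sqnorm R (yh (t - j) - y (t - j))))"

definition mhe_minimizer ::
  "(real^'n \<Rightarrow> real^'m \<Rightarrow> real^'q \<Rightarrow> real^'n) \<Rightarrow> (real^'n \<Rightarrow> real^'m \<Rightarrow> real^'q \<Rightarrow> real^'p) \<Rightarrow>
   (real^'n) set \<Rightarrow> (real^'q) set \<Rightarrow> (real^'p) set \<Rightarrow>
   real \<Rightarrow> real^'n^'n \<Rightarrow> real^'q^'q \<Rightarrow> real^'p^'p \<Rightarrow> nat \<Rightarrow>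
   (nat \<Rightarrow> real^'m) \<Rightarrow> (nat \<Rightarrow> real^'p) \<Rightarrow> (nat \<Rightarrow> real^'n) \<Rightarrow> nat \<Rightarrow>
   (nat \<Rightarrow> real^'n) \<Rightarrow> (nat \<Rightarrow> real^'q) \<Rightarrow> (nat \<Rightarrow> real^'p) \<Rightarrow> bool" where
  "mhe_minimizer f h X W Y \<eta> P2 Q R M u y xhat t xs ws ys \<longleftrightarrow>
     mhe_feasible f h X W Y M u t xs ws ys \<and>
     (\<forall>xh wh yh. mhe_feasible f h X W Y M u t xh wh yh \<longrightarrow>
        mhe_cost \<eta> P2 Q R M y xhat t xs ws ys \<le> mhe_cost \<eta> P2 Q R M y xhat t xh wh yh)"

(* At each time any minimizer may be selected.  For M = 0 and t > 0 the prior in the cost is the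
   current estimate itself, so the condition at t then only says that it lies in X. *)
definition mhe_estimates ::
  "(real^'n \<Rightarrow> real^'m \<Rightarrow> real^'q \<Rightarrow> real^'n) \<Rightarrow> (real^'n \<Rightarrow> real^'m \<Rightarrow> real^'q \<Rightarrow> real^'p) \<Rightarrow>
   (real^'n) set \<Rightarrow> (real^'q) set \<Rightarrow> (real^'p) set \<Rightarrow>
   real \<Rightarrow> real^'n^'n \<Rightarrow> real^'q^'q \<Rightarrow> real^'p^'p \<Rightarrow> nat \<Rightarrow>
   (nat \<Rightarrow> real^'m) \<Rightarrow> (nat \<Rightarrow> real^'p) \<Rightarrow> real^'n \<Rightarrow> (nat \<Rightarrow> real^'n) \<Rightarrow> bool" where
  "mhe_estimates f h X W Y \<eta> P2 Q R M u y xguess xhat \<longleftrightarrow>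
     xhat 0 = xguess \<and>
     (\<forall>t. \<exists>xs ws ys. mhe_minimizer f h X W Y \<eta> P2 Q R M u y xhat t xs ws ys \<and> xhat t = xs t)"

end

theory Submission
  imports Defs
begin

(* Iterating the dissipation inequality along the optimal and the true trajectory over the horizon
   bounds W_delta at time t; splitting each squared norm by |a + b|^2 <= 2|a|^2 + 2|b|^2 produces
   exactly the optimal cost plus terms of the true system.  The true trajectory is itself feasible,
   so the optimal cost may be replaced by its cost, where the output terms vanish.  The weight P2 is
   finally traded for P1 through the largest generalized eigenvalue, which is the maximum of the
   Rayleigh quotient of (P2, P1) over the unit sphere. *)

lemma sqnorm_scaleR: "sqnorm A (c *\<^sub>R v) = c\<^sup>2 * sqnorm A v"
  by (simp add: sqnorm_def matrix_vector_mult_scaleR power2_eq_square)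

lemma sqnorm_zero [simp]: "sqnorm A 0 = 0"
  by (simp add: sqnorm_def)

lemma sqnorm_diff_matrix: "sqnorm (A - l *\<^sub>R B) v = sqnorm A v - l * sqnorm B v"
  by (simp add: sqnorm_def matrix_vector_mult_diff_rdistrib inner_diff_right
      flip: scaleR_matrix_vector_assoc)

lemma pos_def_imp_pos_semidef:
  assumes "pos_def A"
  shows "pos_semidef A"
  unfolding pos_semidef_def
proof (intro conjI allI)
  show "transpose A = A"
    using assms by (simp add: pos_def_def)
  show "0 \<le> v \<bullet> (A *v v)" for v
    using assms by (cases "v = 0") (simp_all add: pos_def_def less_imp_le)
qed

lemma sqnorm_nonneg: "pos_semidef A \<Longrightarrow> 0 \<le> sqnorm A v"
  by (simp add: pos_semidef_def sqnorm_def)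

lemma sqnorm_pos: "pos_def A \<Longrightarrow> v \<noteq> 0 \<Longrightarrow> 0 < sqnorm A v"
  by (simp add: pos_def_def sqnorm_def)

lemma sqnorm_parallelogram: "sqnorm A (a + b) + sqnorm A (a - b) = 2 * sqnorm A a + 2 * sqnorm A b"
  by (simp add: sqnorm_def matrix_vector_right_distrib matrix_vector_mult_diff_distrib
      inner_add_left inner_add_right inner_diff_left inner_diff_right)

text \<open>The second term of the parallelogram identity is nonnegative and is dropped. This
  splitting is the origin of the factors 2 in the MHE cost.\<close>

lemma sqnorm_add_le:
  assumes "pos_semidef A"
  shows "sqnorm A (a + b) \<le> 2 * sqnorm A a + 2 * sqnorm A b"
  using sqnorm_parallelogram[of A a b] sqnorm_nonneg[OF assms, of "a - b"] by linarith

lemma sqnorm_minus: "sqnorm A (- v) = sqnorm A v"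
  using sqnorm_scaleR[of A "-1" v] by simp

lemma sqnorm_minus_commute: "sqnorm A (a - b) = sqnorm A (b - a)"
  using sqnorm_minus[of A "a - b"] by simp

lemma sqnorm_diff_le:
  assumes "pos_semidef A"
  shows "sqnorm A (a - b) \<le> 2 * sqnorm A a + 2 * sqnorm A b"
  using sqnorm_add_le[OF assms, of a "- b"] by (simp add: sqnorm_minus)

text \<open>A semidefinite form attains its minimum 0 at \<open>v\<close>, so its gradient
  \<open>2 * S *v v\<close> vanishes there. Concretely, moving from \<open>v\<close> against
  \<open>z = S *v v\<close> would make the form negative unless \<open>z = 0\<close>.\<close>

lemma pos_semidef_null_vector:
  assumes "pos_semidef S" and "sqnorm S v = 0"
  shows "S *v v = 0"
proof -
  define z a c where "z = S *v v" and "a = z \<bullet> z" and "c = sqnorm S z"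
  have sym: "v \<bullet> (S *v z) = a"
    using assms(1) dot_lmul_matrix[of v S z] by (simp add: pos_semidef_def a_def z_def
        flip: transpose_matrix_vector)
  have expand: "sqnorm S (v + r *\<^sub>R z) = 2 * r * a + r\<^sup>2 * c" for r
    using assms(2) sym by (simp add: sqnorm_def c_def a_def matrix_vector_right_distrib
        matrix_vector_mult_scaleR inner_add_left inner_add_right power2_eq_square
        algebra_simps flip: z_def)
  have "0 \<le> c"
    using sqnorm_nonneg[OF assms(1)] by (simp add: c_def)
  \<comment> \<open>The step \<open>r = - a / (c + 1)\<close> is close to the minimizer
    \<open>- a / c\<close> of the quadratic in \<open>r\<close>; the added 1 covers
    \<open>c = 0\<close>.\<close>
  have "0 \<le> 2 * (- a / (c + 1)) * a + (- a / (c + 1))\<^sup>2 * c"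
    using sqnorm_nonneg[OF assms(1)] expand by metis
  also have "\<dots> = - (a\<^sup>2 * (c + 2) / (c + 1)\<^sup>2)"
    using \<open>0 \<le> c\<close> by (simp add: divide_simps) algebra
  finally have "a\<^sup>2 * (c + 2) / (c + 1)\<^sup>2 \<le> 0" by simp
  then have "a = 0"
    using \<open>0 \<le> c\<close> by (simp add: divide_le_0_iff mult_le_0_iff)
  then show ?thesis
    by (simp add: a_def z_def)
qed

lemma continuous_on_sqnorm: "continuous_on S (sqnorm A)"
  unfolding sqnorm_def[abs_def]
  by (intro continuous_intros linear_continuous_on_compose matrix_vector_mul_linear)

text \<open>The quotient \<open>q\<close> is continuous on the compact unit sphere and invariant
  under scaling, so its maximum on the sphere bounds it at every nonzero vector.\<close>

lemma Rayleigh_quotient_max: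
  fixes A B :: "real^'k^'k"
  assumes "pos_def B"
  obtains l e where "e \<noteq> 0" "sqnorm A e = l * sqnorm B e" "\<And>v. sqnorm A v \<le> l * sqnorm B v"
proof -
  define q where "q = (\<lambda>v. sqnorm A v / sqnorm B v)"
  have pos: "0 < sqnorm B v" if "v \<noteq> 0" for v
    using assms that by (rule sqnorm_pos)
  have "sqnorm B v \<noteq> 0" if "v \<in> sphere 0 1" for v
    using pos[of v] that by fastforce
  then have "continuous_on (sphere 0 1) q"
    unfolding q_def by (intro continuous_on_divide continuous_on_sqnorm) blast
  \<comment> \<open>Any unit coordinate vector shows that the sphere is nonempty.\<close>
  moreover have "axis undefined 1 \<in> sphere (0::real^'k) 1"
    by (simp add: norm_axis_1)
  ultimately obtain e where e: "e \<in> sphere 0 1" "\<And>v. v \<in> sphere 0 1 \<Longrightarrow> q v \<le> q e"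
    using continuous_attains_sup[of "sphere (0::real^'k) 1" q] by auto
  have "e \<noteq> 0" using e(1) by auto
  have "sqnorm A v \<le> q e * sqnorm B v" for v
  proof (cases "v = 0")
    case False
    then have "q (v /\<^sub>R norm v) \<le> q e"
      by (intro e(2)) simp
    also have "q (v /\<^sub>R norm v) = q v"
      using False by (simp add: q_def sqnorm_scaleR)
    finally show ?thesis
      using pos[OF False] by (simp add: q_def field_simps)
  qed simp
  moreover have "sqnorm A e = q e * sqnorm B e"
    using pos[OF \<open>e \<noteq> 0\<close>] by (simp add: q_def)
  ultimately show thesis
    using that \<open>e \<noteq> 0\<close> by blast
qed

lemma det_zero_iff_null_vector:
  fixes A :: "real^'k^'k"
  shows "det A = 0 \<longleftrightarrow> (\<exists>v. v \<noteq> 0 \<and> A *v v = 0)"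
  by (metis invertible_det_nz invertible_left_inverse matrix_left_invertible_ker)

text \<open>With \<open>l\<close> the maximal Rayleigh quotient, \<open>l *\<^sub>R B - A\<close> is
  positive semidefinite and its form vanishes at the maximizer \<open>e\<close>, so \<open>e\<close>
  is a null vector and \<open>l\<close> a root of the determinant. Any root \<open>m\<close> is the
  quotient at its own null vector, hence at most \<open>l\<close>. Thus the \<open>GREATEST\<close>
  in \<open>lambda_max\<close> is attained and equals \<open>l\<close>.\<close>

lemma sqnorm_le_lambda_max:
  fixes A B :: "real^'k^'k"
  assumes "pos_def A" and "pos_def B"
  shows "sqnorm A v \<le> lambda_max A B * sqnorm B v"
proof -
  obtain l e where le: "e \<noteq> 0" "sqnorm A e = l * sqnorm B e"
    "\<And>v. sqnorm A v \<le> l * sqnorm B v"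
    using Rayleigh_quotient_max[OF assms(2)] by blast
  have neg: "sqnorm (l *\<^sub>R B - A) v = l * sqnorm B v - sqnorm A v" for v
    by (simp add: sqnorm_def matrix_vector_mult_diff_rdistrib inner_diff_right
        flip: scaleR_matrix_vector_assoc)
  have "transpose (l *\<^sub>R B - A) = l *\<^sub>R B - A"
    using assms by (simp add: pos_def_def transpose_def vec_eq_iff)
  moreover have "0 \<le> v \<bullet> ((l *\<^sub>R B - A) *v v)" for v
    using le(3)[of v] neg[of v] by (simp add: sqnorm_def)
  ultimately have "pos_semidef (l *\<^sub>R B - A)"
    by (simp add: pos_semidef_def)
  then have "(l *\<^sub>R B - A) *v e = 0"
    by (rule pos_semidef_null_vector) (simp add: neg le(2))
  then have "(A - l *\<^sub>R B) *v e = 0"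
    by (simp add: matrix_vector_mult_diff_rdistrib)
  then have root: "det (A - l *\<^sub>R B) = 0"
    using le(1) det_zero_iff_null_vector by blast
  have "m \<le> l" if m: "det (A - m *\<^sub>R B) = 0" for m
  proof -
    obtain v where v: "v \<noteq> 0" "(A - m *\<^sub>R B) *v v = 0"
      using m det_zero_iff_null_vector by blast
    then have "sqnorm (A - m *\<^sub>R B) v = 0"
      by (simp add: sqnorm_def)
    then have "m * sqnorm B v \<le> l * sqnorm B v"
      using le(3)[of v] by (simp add: sqnorm_diff_matrix)
    then show ?thesis
      using sqnorm_pos[OF assms(2) v(1)] by simp
  qed
  with root have "lambda_max A B = l"
    unfolding lambda_max_def by (rule Greatest_equality)
  then show ?thesis
    using le(3) by simp
qed

text \<open>The index \<open>j\<close> counts backwards from the end of the window, as in the MHE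
  cost: the latest supply term is undiscounted and each earlier one gains a factor \<eta>.\<close>

lemma discounted_iterate:
  fixes a g :: "nat \<Rightarrow> real"
  assumes "0 \<le> \<eta>" and "\<And>i. s \<le> i \<Longrightarrow> i < s + k \<Longrightarrow> a (Suc i) \<le> \<eta> * a i + g i"
  shows "a (s + k) \<le> \<eta> ^ k * a s + (\<Sum>j=1..k. \<eta> ^ (j - 1) * g (s + k - j))"
  using assms(2)
proof (induction k)
  case (Suc k)
  have "a (s + Suc k) \<le> \<eta> * a (s + k) + g (s + k)"
    using Suc.prems[of "s + k"] by simp
  also have "\<dots> \<le> \<eta> * (\<eta> ^ k * a s + (\<Sum>j=1..k. \<eta> ^ (j - 1) * g (s + k - j))) + g (s + k)"
    using Suc assms(1) by (intro add_right_mono mult_left_mono) auto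
  also have "\<dots> = \<eta> ^ Suc k * a s + (g (s + k) + (\<Sum>j=1..k. \<eta> ^ j * g (s + k - j)))"
  proof -
    have "\<eta> * (\<eta> ^ (j - 1) * g (s + k - j)) = \<eta> ^ j * g (s + k - j)" if "j \<in> {1..k}" for j
      using that by (cases j) simp_all
    then have "\<eta> * (\<Sum>j=1..k. \<eta> ^ (j - 1) * g (s + k - j)) = (\<Sum>j=1..k. \<eta> ^ j * g (s + k - j))"
      unfolding sum_distrib_left by (rule sum.cong[OF refl])
    then show ?thesis
      by (simp add: distrib_left)
  qed
  \<comment> \<open>The new supply term is the summand \<open>j = 0\<close>, with
    \<open>\<eta> ^ 0 = 1\<close> even for \<eta> = 0; shifting the index by one then restores the
    range from 1.\<close>
  also have "g (s + k) + (\<Sum>j=1..k. \<eta> ^ j * g (s + k - j))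
      = (\<Sum>j=1..Suc k. \<eta> ^ (j - 1) * g (s + Suc k - j))"
    using sum.atLeast_Suc_atMost[of 0 k "\<lambda>j. \<eta> ^ j * g (s + k - j)"]
      sum.shift_bounds_cl_Suc_ivl[of "\<lambda>j. \<eta> ^ (j - 1) * g (s + Suc k - j)" 0 k]
    by simp
  finally show ?case .
qed simp

theorem theorem1:
  fixes f :: "real^'n \<Rightarrow> real^'m \<Rightarrow> real^'q \<Rightarrow> real^'n"
    and h :: "real^'n \<Rightarrow> real^'m \<Rightarrow> real^'q \<Rightarrow> real^'p"
    and X :: "(real^'n) set" and U :: "(real^'m) set"
    and W :: "(real^'q) set" and Y :: "(real^'p) set"
    and x xhat :: "nat \<Rightarrow> real^'n" and u :: "nat \<Rightarrow> real^'m"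
    and w :: "nat \<Rightarrow> real^'q" and y :: "nat \<Rightarrow> real^'p"
    and xguess :: "real^'n"
    and W\<^sub>\<delta> :: "real^'n \<Rightarrow> real^'n \<Rightarrow> real"
    and \<eta> :: real and P1 P2 :: "real^'n^'n" and Q :: "real^'q^'q" and R :: "real^'p^'p"
    and M t :: nat
  assumes "continuous_on UNIV (\<lambda>(a, b, c). f a b c)"
    and "continuous_on UNIV (\<lambda>(a, b, c). h a b c)"
    and "system_trajectory f h (X \<times> U \<times> W \<times> Y) x u w y"
    and "xguess \<in> X"
    and "delta_IOSS_lyapunov f h (X \<times> U \<times> W \<times> Y) \<eta> P1 P2 Q R W\<^sub>\<delta>"
    and "mhe_estimates f h X W Y \<eta> P2 Q R M u y xguess xhat"
  shows "W\<^sub>\<delta> (xhat t) (x t)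
    \<le> 4 * \<eta> ^ min t M * lambda_max P2 P1 * W\<^sub>\<delta> (xhat (t - min t M)) (x (t - min t M))
      + 4 * (\<Sum>j=1..min t M. \<eta> ^ (j - 1) * sqnorm Q (w (t - j)))"
proof -
  define Z N s where "Z = X \<times> U \<times> W \<times> Y" and "N = min t M" and "s = t - min t M"
  have t: "t = s + N" by (simp add: N_def s_def)
  note sys = assms(3)[unfolded system_trajectory_def, folded Z_def, rule_format]
  have x_step: "x (Suc i) = f (x i) (u i) (w i)" for i
    using sys[of i] by simp
  have y_def: "y i = h (x i) (u i) (w i)" for i
    using sys[of i] by simp
  have in_Z: "(x i, u i, w i, y i) \<in> Z" for i
    using sys[of i] by blast
  have eta: "0 \<le> \<eta>" and P1: "pos_def P1" and P2: "pos_def P2" and Q: "pos_semidef Q"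
    and V0: "\<And>a b. 0 \<le> W\<^sub>\<delta> a b"
    using assms(5) by (simp_all add: delta_IOSS_lyapunov_def)
  have bounds: "sqnorm P1 (a - x i) \<le> W\<^sub>\<delta> a (x i)" "W\<^sub>\<delta> a (x i) \<le> sqnorm P2 (a - x i)"
    if "a \<in> X" for a i
  proof -
    \<comment> \<open>The quadratic bounds do not impose the output relation, so \<open>a\<close>
      may borrow input, disturbance and output from the true trajectory.\<close>
    have "(a, u i, w i, y i) \<in> Z"
      using that in_Z[of i] by (simp add: Z_def)
    moreover have "\<forall>x u w y x' w' y'. (x, u, w, y) \<in> Z \<and> (x', u, w', y') \<in> Z \<longrightarrow>
        sqnorm P1 (x - x') \<le> W\<^sub>\<delta> x x' \<and> W\<^sub>\<delta> x x' \<le> sqnorm P2 (x - x')"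
      using assms(5) unfolding delta_IOSS_lyapunov_def Z_def[symmetric] by (elim conjE)
    ultimately show "sqnorm P1 (a - x i) \<le> W\<^sub>\<delta> a (x i)" "W\<^sub>\<delta> a (x i) \<le> sqnorm P2 (a - x i)"
      using in_Z[of i] by blast+
  qed
  have Vstep: "W\<^sub>\<delta> (f a (u i) c) (x (Suc i))
      \<le> \<eta> * W\<^sub>\<delta> a (x i) + sqnorm Q (c - w i) + sqnorm R (d - y i)"
    if "(a, u i, c, d) \<in> Z" "d = h a (u i) c" for a i c d
  proof -
    have "\<forall>x u w y x' w' y'. (x, u, w, y) \<in> Z \<and> (x', u, w', y') \<in> Z \<and>
        y = h x u w \<and> y' = h x' u w' \<longrightarrow>
        W\<^sub>\<delta> (f x u w) (f x' u w') \<le> \<eta> * W\<^sub>\<delta> x x' + sqnorm Q (w - w') + sqnorm R (y - y')"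
      using assms(5) unfolding delta_IOSS_lyapunov_def Z_def[symmetric] by (elim conjE)
    then show ?thesis
      using that in_Z[of i] y_def[of i] unfolding x_step[of i] by metis
  qed
  obtain xs ws ys where opt: "mhe_minimizer f h X W Y \<eta> P2 Q R M u y xhat t xs ws ys"
    and xt: "xhat t = xs t"
    using assms(6) unfolding mhe_estimates_def by blast
  \<comment> \<open>The state constraint includes the right end of the window, which is where the
    estimate is read off.\<close>
  have est_in_X: "xhat i \<in> X" for i
    using assms(6) unfolding mhe_estimates_def mhe_minimizer_def mhe_feasible_def
    by (metis atLeastAtMost_iff diff_le_self le_refl)
  have feas: "mhe_feasible f h X W Y M u t xs ws ys"
    using opt by (simp add: mhe_minimizer_def)
  have true_feas: "mhe_feasible f h X W Y M u t x w y"
    unfolding mhe_feasible_def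
    using x_step y_def in_Z unfolding Z_def by simp
  have xs_X: "xs s \<in> X"
    using feas by (simp add: mhe_feasible_def s_def)
  have cost: "mhe_cost \<eta> P2 Q R M y xhat t xh wh yh = 2 * \<eta> ^ N * sqnorm P2 (xh s - xhat s) +
      (\<Sum>j=1..N. \<eta> ^ (j - 1) * (2 * sqnorm Q (wh (t - j)) + sqnorm R (yh (t - j) - y (t - j))))"
    for xh wh yh
    by (simp only: mhe_cost_def N_def s_def)
  define D where "D = sqnorm P2 (xhat s - x s)"
  define S where "S = (\<Sum>j=1..N. \<eta> ^ (j - 1) * sqnorm Q (w (t - j)))"
  have "W\<^sub>\<delta> (xs (s + N)) (x (s + N)) \<le> \<eta> ^ N * W\<^sub>\<delta> (xs s) (x s) + (\<Sum>j=1..N. \<eta> ^ (j - 1) *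
      (sqnorm Q (ws (s + N - j) - w (s + N - j)) + sqnorm R (ys (s + N - j) - y (s + N - j))))"
  proof (rule discounted_iterate[OF eta])
    fix i assume "s \<le> i" "i < s + N"
    then have "i \<in> {t - min t M..<t}"
      unfolding s_def[symmetric] t[symmetric] by simp
    then have "xs (Suc i) = f (xs i) (u i) (ws i)" "ys i = h (xs i) (u i) (ws i)"
      "ws i \<in> W" "ys i \<in> Y" "xs i \<in> X"
      using feas unfolding mhe_feasible_def by (metis Suc_eq_plus1, metis, metis, metis, simp)
    \<comment> \<open>Only \<open>u i \<in> U\<close> comes from the true trajectory; the rest is
      feasibility of the optimal one.\<close>
    moreover from this have "(xs i, u i, ws i, ys i) \<in> Z"
      using in_Z[of i] unfolding Z_def by blast
    ultimately show "W\<^sub>\<delta> (xs (Suc i)) (x (Suc i)) \<le> \<eta> * W\<^sub>\<delta> (xs i) (x i) +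
        (sqnorm Q (ws i - w i) + sqnorm R (ys i - y i))"
      using Vstep[of "xs i" i "ws i" "ys i"] by simp
  qed
  also have "\<dots> \<le> \<eta> ^ N * (2 * sqnorm P2 (xs s - xhat s) + 2 * D) +
      (\<Sum>j=1..N. \<eta> ^ (j - 1) * (2 * sqnorm Q (ws (t - j)) + 2 * sqnorm Q (w (t - j))
        + sqnorm R (ys (t - j) - y (t - j))))"
  proof (intro add_mono mult_left_mono sum_mono)
    \<comment> \<open>The initial error is split at the prior \<open>xhat s\<close>: one part is
      penalized in the cost, the other is the prior error \<open>D\<close>.\<close>
    show "W\<^sub>\<delta> (xs s) (x s) \<le> 2 * sqnorm P2 (xs s - xhat s) + 2 * D"
      using bounds(2)[OF xs_X, of s]
        sqnorm_add_le[OF pos_def_imp_pos_semidef[OF P2], of "xs s - xhat s" "xhat s - x s"]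
      by (simp add: D_def)
  qed (use eta in \<open>simp_all add: t sqnorm_diff_le[OF Q]\<close>)
  also have "\<dots> = mhe_cost \<eta> P2 Q R M y xhat t xs ws ys + 2 * \<eta> ^ N * D + 2 * S"
    unfolding cost S_def sum_distrib_left distrib_left sum.distrib
    by (simp add: mult.left_commute)
  also have "\<dots> \<le> mhe_cost \<eta> P2 Q R M y xhat t x w y + 2 * \<eta> ^ N * D + 2 * S"
    using opt true_feas by (simp add: mhe_minimizer_def)
  \<comment> \<open>The output residuals of the true trajectory are zero, so its cost is
    \<open>2 * \<eta> ^ N * D + 2 * S\<close>, the same as the terms already present.\<close>
  also have "\<dots> = 4 * \<eta> ^ N * D + 4 * S"
    unfolding cost S_def D_def sum_distrib_left sqnorm_minus_commute[of P2 "x s" "xhat s"]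
    by (simp add: sum_distrib_left mult.left_commute)
  finally have main: "W\<^sub>\<delta> (xhat t) (x t) \<le> 4 * \<eta> ^ N * D + 4 * S"
    by (simp add: xt flip: t)
  \<comment> \<open>Replacing the \<open>P1\<close> form by its upper bound
    \<open>W\<^sub>\<delta>\<close> requires \<open>lambda_max P2 P1\<close> to be nonnegative. This
    sign is read off from the two positive forms at a nonzero error; for zero error both sides
    vanish.\<close>
  have "D \<le> lambda_max P2 P1 * W\<^sub>\<delta> (xhat s) (x s)"
  proof (cases "xhat s = x s")
    case True
    then have "W\<^sub>\<delta> (xhat s) (x s) = 0"
      using bounds(2)[OF est_in_X[of s], of s] V0[of "xhat s" "x s"] by simp
    then show ?thesis
      using True by (simp add: D_def)
  next
    case False
    then have "0 < sqnorm P2 (xhat s - x s)" "0 < sqnorm P1 (xhat s - x s)"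
      using P1 P2 by (simp_all add: sqnorm_pos)
    moreover have le: "D \<le> lambda_max P2 P1 * sqnorm P1 (xhat s - x s)"
      using sqnorm_le_lambda_max[OF P2 P1] by (simp add: D_def)
    ultimately have "0 \<le> lambda_max P2 P1"
      by (smt (verit) D_def mult_nonpos_nonneg)
    then show ?thesis
      using le bounds(1)[OF est_in_X[of s], of s] by (meson mult_left_mono order_trans)
  qed
  then have "4 * \<eta> ^ N * D \<le> 4 * \<eta> ^ N * (lambda_max P2 P1 * W\<^sub>\<delta> (xhat s) (x s))"
    using eta by (intro mult_left_mono) auto
  with main show ?thesis
    by (simp add: S_def N_def s_def mult.assoc)
qed

end
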